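(* Suppose that $\boldsymbol{A}\in \mathbb{DQ}^{m \times n}$ with $\mathrm{rank}(\boldsymbol{A})=r > 0$. Then there exist an $n\times n$ permutation matrix $\Pi$, a unitary matrix $\boldsymbol{Q}\in \mathbb{DQ}^{m \times m}$ and an upper trapezoidal matrix $\boldsymbol{R}\in \mathbb{DQ}^{r \times n}$ such that $$\boldsymbol{A}\Pi=\boldsymbol{Q}\begin{pmatrix}\boldsymbol{R}\\ 0\end{pmatrix},$$ where the number of non-infinitesimal rows of $\boldsymbol{R}$ equals the appreciable rank $\mathrm{Arank}(\boldsymbol{A})$.
   Context: Dual numbers: $\mathbb{D}=\{a+b\epsilon: a,b\in\mathbb{R}\}$ with $\epsilon\neq0$, $\epsilon^2=0$; $a+b\epsilon$ is appreciable if $a\ne0$ and infinitesimal otherwise. $\mathbb{D}$ is totally ordered lexicographically: $a+b\epsilon>a'+b'\epsilon$ iff $a>a'$, or $a=a'$ and $b>b'$. $\mathbb{Q}$ denotes the real (Hamilton) quaternions, and $\mathbb{DQ}=\{\mathbf{q}_{st}+\mathbf{q}_{in}\epsilon:\mathbf{q}_{st},\mathbf{q}_{in}\in\mathbb{Q}\}$ the dual quaternions, where $\epsilon$ commutes with quaternions; conjugation is $\mathbf{q}_{st}^*+\mathbf{q}_{in}^*\epsilon$. A vector or matrix over $\mathbb{DQ}$ is $\mathbf{A}_{st}+\mathbf{A}_{in}\epsilon$ with quaternion $\mathbf{A}_{st},\mathbf{A}_{in}$; it is infinitesimal if $\mathbf{A}_{st}=0$ and appreciable otherwise. $\boldsymbol{A}^*$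 is the conjugate transpose. A square $\boldsymbol{U}$ is unitary if $\boldsymbol{U}^*\boldsymbol{U}=\boldsymbol{U}\boldsymbol{U}^*=I$. Upper trapezoidal means that all entries below the main diagonal are zero. Rank: every $\boldsymbol{A}\in\mathbb{DQ}^{m\times n}$ has a singular value decomposition (known) $\boldsymbol{U}^*\boldsymbol{A}\boldsymbol{V}=\begin{pmatrix}\mathrm{diag}(\mu_1,\dots,\mu_t)&0\\0&0\end{pmatrix}$ with $\boldsymbol{U},\boldsymbol{V}$ unitary, $\mu_1\ge\cdots\ge\mu_{r'}$ positive appreciable dual numbers and $\mu_{r'+1}\ge\cdots\ge\mu_t$ positive infinitesimal dual numbers; the $\mu_i$ are unique. Then $\mathrm{rank}(\boldsymbol{A})=t$ and $\mathrm{Arank}(\boldsymbol{A})=r'$. *)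

theory Defs
  imports "Jordan_Normal_Form.Matrix" "HOL-Combinatorics.Permutations"
begin

section \<open>Quaternions\<close>

datatype quat = Quat (qre: real) (qi: real) (qj: real) (qk: real)

lemma quat_eq_iff: "x = y \<longleftrightarrow> qre x = qre y \<and> qi x = qi y \<and> qj x = qj y \<and> qk x = qk y"
  by (cases x; cases y) simp

instantiation quat :: real_algebra_1
begin

definition "0 = Quat 0 0 0 0"
definition "1 = Quat 1 0 0 0"
definition "x + y = Quat (qre x + qre y) (qi x + qi y) (qj x + qj y) (qk x + qk y)"
definition "- x = Quat (- qre x) (- qi x) (- qj x) (- qk x)"
definition "x - y = Quat (qre x - qre y) (qi x - qi y) (qj x - qj y) (qk x - qk y)"
definition "x * y = Quat
  (qre x * qre y - qi x * qi y - qj x * qj y - qk x * qk y)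
  (qre x * qi y + qi x * qre y + qj x * qk y - qk x * qj y)
  (qre x * qj y - qi x * qk y + qj x * qre y + qk x * qi y)
  (qre x * qk y + qi x * qj y - qj x * qi y + qk x * qre y)"
definition "c *\<^sub>R x = Quat (c * qre x) (c * qi x) (c * qj x) (c * qk x)"

instance
  by standard
    (simp_all add: quat_eq_iff zero_quat_def one_quat_def plus_quat_def uminus_quat_def
      minus_quat_def times_quat_def scaleR_quat_def algebra_simps)

end

instantiation quat :: conjugate
begin

definition "conjugate x = Quat (qre x) (- qi x) (- qj x) (- qk x)"

instance
  by standard (auto simp: conjugate_quat_def quat_eq_iff)

end

section \<open>Dual numbers over a ring\<close>

text \<open>The element \<open>Dual a b\<close> is \<open>a + b \<epsilon>\<close>, where \<open>\<epsilon>\<close> is central and \<open>\<epsilon>\<^sup>2 = 0\<close>.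
  The type \<open>real dual\<close> consists of the dual numbers, \<open>quat dual\<close> of the dual quaternions.\<close>

datatype 'a dual = Dual (st: 'a) (inf_part: 'a)

lemma dual_eq_iff: "x = y \<longleftrightarrow> st x = st y \<and> inf_part x = inf_part y"
  by (cases x; cases y) simp

instantiation dual :: (ring_1) ring_1
begin

definition "0 = Dual 0 0"
definition "1 = Dual 1 0"
definition "x + y = Dual (st x + st y) (inf_part x + inf_part y)"
definition "- x = Dual (- st x) (- inf_part x)"
definition "x - y = Dual (st x - st y) (inf_part x - inf_part y)"
definition "x * y = Dual (st x * st y) (st x * inf_part y + inf_part x * st y)"

instance
  by standard
    (simp_all add: dual_eq_iff zero_dual_def one_dual_def plus_dual_def uminus_dual_def
      minus_dual_def times_dual_def algebra_simps)

end

instantiation dual :: (linorder) linorder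
begin

definition "x < y \<longleftrightarrow> st x < st y \<or> st x = st y \<and> inf_part x < inf_part y"
definition "x \<le> y \<longleftrightarrow> st x < st y \<or> st x = st y \<and> inf_part x \<le> inf_part y"

instance
  by standard (auto simp: less_dual_def less_eq_dual_def dual_eq_iff)

end

instantiation dual :: (conjugate) conjugate
begin

definition "conjugate x = Dual (conjugate (st x)) (conjugate (inf_part x))"

instance
  by standard (auto simp: conjugate_dual_def dual_eq_iff)

end

definition appreciable :: "'a::zero dual \<Rightarrow> bool" where
  "appreciable x \<longleftrightarrow> st x \<noteq> 0"

definition infinitesimal_vec :: "'a::zero dual vec \<Rightarrow> bool" where
  "infinitesimal_vec v \<longleftrightarrow> map_vec st v = 0\<^sub>v (dim_vec v)"

type_synonym dquat = "quat dual"

definition dquat_of_dual :: "real dual \<Rightarrow> dquat" where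
  "dquat_of_dual = map_dual of_real"

section \<open>Matrices\<close>

text \<open>The library adjoint is restricted to commutative fields, hence the following version.\<close>

definition conj_transpose :: "'a::conjugate mat \<Rightarrow> 'a mat" where
  "conj_transpose A = map_mat conjugate (transpose_mat A)"

definition unitary_mat :: "nat \<Rightarrow> 'a::{ring_1,conjugate} mat \<Rightarrow> bool" where
  "unitary_mat n U \<longleftrightarrow> U \<in> carrier_mat n n \<and>
     conj_transpose U * U = 1\<^sub>m n \<and> U * conj_transpose U = 1\<^sub>m n"

definition permutation_mat :: "nat \<Rightarrow> 'a::{zero,one} mat \<Rightarrow> bool" where
  "permutation_mat n P \<longleftrightarrow>
     (\<exists>\<pi>. \<pi> permutes {..<n} \<and> P = mat n n (\<lambda>(i, j). if i = \<pi> j then 1 else 0))"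

definition upper_trapezoidal :: "'a::zero mat \<Rightarrow> bool" where
  "upper_trapezoidal A \<longleftrightarrow> (\<forall>i<dim_row A. \<forall>j<dim_col A. j < i \<longrightarrow> A $$ (i, j) = 0)"

section \<open>Singular values and rank\<close>

definition svd_diag :: "nat \<Rightarrow> nat \<Rightarrow> real dual list \<Rightarrow> dquat mat" where
  "svd_diag m n \<mu>s =
     mat m n (\<lambda>(i, j). if i = j \<and> i < length \<mu>s then dquat_of_dual (\<mu>s ! i) else 0)"

text \<open>Since a positive appreciable dual number exceeds every infinitesimal one, a decreasing list
  of positive dual numbers lists the appreciable ones first.\<close>

definition is_svd :: "dquat mat \<Rightarrow> dquat mat \<Rightarrow> dquat mat \<Rightarrow> real dual list \<Rightarrow> bool" where
  "is_svd A U V \<mu>s \<longleftrightarrow>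
     unitary_mat (dim_row A) U \<and> unitary_mat (dim_col A) V \<and>
     length \<mu>s \<le> min (dim_row A) (dim_col A) \<and>
     sorted_wrt (\<ge>) \<mu>s \<and> (\<forall>\<mu>\<in>set \<mu>s. 0 < \<mu>) \<and>
     conj_transpose U * A * V = svd_diag (dim_row A) (dim_col A) \<mu>s"

text \<open>Every matrix has a singular value decomposition, and its list of singular values is unique.
  So the choice below is determined by the matrix, and the value \<open>[]\<close> for a matrix without
  decomposition is only a default that never occurs.\<close>

definition singular_values :: "dquat mat \<Rightarrow> real dual list" where
  "singular_values A =
     (if \<exists>\<mu>s U V. is_svd A U V \<mu>s then SOME \<mu>s. \<exists>U V. is_svd A U V \<mu>s else [])"

definition dq_rank :: "dquat mat \<Rightarrow> nat" where
  "dq_rank A = length (singular_values A)"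

definition Arank :: "dquat mat \<Rightarrow> nat" where
  "Arank A = length (filter appreciable (singular_values A))"

end

theory Submission
  imports Defs
begin

text \<open>
  A positive rank provides a singular value decomposition. Moving the unitary factor \<open>V\<close> to the
  right gives \<open>A = U (B; 0)\<close>, where \<open>B\<close> is the \<open>r \<times> n\<close> matrix whose row \<open>i\<close> is \<open>\<mu>\<^sub>i\<close> times row
  \<open>i\<close> of \<open>V\<^sup>*\<close> (\<open>svd_reduced\<close>). A decomposition \<open>W B P = R\<close> with \<open>W\<close> unitary and \<open>R\<close>
  upper trapezoidal then yields \<open>A P = U diag(W\<^sup>*, I) (R; 0)\<close>, so that everything takes place in the
  \<open>r\<close> rows of \<open>B\<close>.

  The decomposition of \<open>B\<close> is QR with column pivoting (\<open>pivoted_qr\<close>). At every stage a column with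
  nonzero standard part is moved to the front as long as the remaining block has one. Hence \<open>R\<close>
  consists of \<open>k\<close> rows with appreciable diagonal entry, followed by infinitesimal rows, and \<open>k\<close>
  is the number of non-infinitesimal rows. One stage requires a unitary matrix that maps a given
  column to a multiple of the first unit vector (\<open>unitary_eliminate\<close>). A quaternion Householder
  reflection does this for the standard part. What remains below the first entry is
  infinitesimal: if the first entry is appreciable, \<open>I + K \<epsilon>\<close> with a skew-Hermitian \<open>K\<close> removes it;
  otherwise the whole column is infinitesimal, and a reflection for the infinitesimal part does.

  It remains to see that \<open>k\<close> is the number \<open>p\<close> of appreciable singular values. Take standard parts.
  The first \<open>k\<close> rows of \<open>R\<close> are triangular with nonzero diagonal, the first \<open>p\<close> rows of \<open>B\<close> are
  nonzero multiples of rows of a unitary matrix, and in both matrices the other rows vanish.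
  Since each of \<open>R\<close> and \<open>B P\<close> is a unitary multiple of the other, comparing the numbers of
  left independent rows gives both inequalities (\<open>independent_rows_le\<close>). The only dimension
  argument needed over the skew field of quaternions is that a matrix with more rows than columns
  has left dependent rows (\<open>quat_left_kernel\<close>), and this again follows from the QR decomposition: the trapezoidal
  factor of a tall matrix has a zero row.
\<close>

section \<open>Rings with an anti-involution\<close>

text \<open>Conjugation of quaternions and of dual quaternions is additive and reverses products. The class
  captures just this, so that unitary matrices of both kinds are treated at once.\<close>

class star_ring = ring_1 + conjugate +
  assumes conjugate_plus: "conjugate (a + b) = conjugate a + conjugate b"
    and conjugate_mult_rev: "conjugate (a * b) = conjugate b * conjugate a"
begin

lemma conjugate_0 [simp]: "conjugate 0 = 0"
  using conjugate_plus[of 0 0] by simp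

lemma conjugate_1 [simp]: "conjugate 1 = 1"
  using conjugate_mult_rev[of "conjugate 1" 1] by simp

lemma conjugate_uminus: "conjugate (- a) = - conjugate a"
  using conjugate_plus[of a "- a"] by (simp add: eq_neg_iff_add_eq_0 add.commute)

lemma conjugate_minus: "conjugate (a - b) = conjugate a - conjugate b"
  using conjugate_plus[of a "- b"] by (simp add: conjugate_uminus)

lemma conjugate_sum: "conjugate (sum f I) = (\<Sum>i\<in>I. conjugate (f i))"
  by (induction I rule: infinite_finite_induct) (simp_all add: conjugate_plus)

end

instance quat :: star_ring
  by standard (simp_all add: quat_eq_iff conjugate_quat_def plus_quat_def times_quat_def)

instance dual :: (star_ring) star_ring
  by standard
    (simp_all add: dual_eq_iff conjugate_dual_def plus_dual_def times_dual_def
      conjugate_plus conjugate_mult_rev add.commute)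

section \<open>Unitary and permutation matrices\<close>

lemma mult_mat_entry:
  fixes A B :: "'a::semiring_0 mat"
  assumes "A \<in> carrier_mat m l" "B \<in> carrier_mat l n" "i < m" "j < n"
  shows "(A * B) $$ (i, j) = (\<Sum>k<l. A $$ (i, k) * B $$ (k, j))"
  using assms by (simp add: scalar_prod_def lessThan_atLeast0)

lemma conj_transpose_carrier [simp]:
  "conj_transpose A \<in> carrier_mat n m \<longleftrightarrow> A \<in> carrier_mat m n"
  by (auto simp: conj_transpose_def)

lemma conj_transpose_entry:
  "A \<in> carrier_mat m n \<Longrightarrow> i < n \<Longrightarrow> j < m \<Longrightarrow> conj_transpose A $$ (i, j) = conjugate (A $$ (j, i))"
  by (auto simp: conj_transpose_def)

lemma conj_transpose_conj_transpose [simp]: "conj_transpose (conj_transpose A) = A"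
  by (rule eq_matI) (simp_all add: conj_transpose_def)

lemma conj_transpose_one [simp]: "conj_transpose (1\<^sub>m n) = (1\<^sub>m n :: 'a::star_ring mat)"
  by (rule eq_matI) (simp_all add: conj_transpose_def)

lemma conj_transpose_mult:
  fixes A B :: "'a::star_ring mat"
  assumes A: "A \<in> carrier_mat m l" and B: "B \<in> carrier_mat l n"
  shows "conj_transpose (A * B) = conj_transpose B * conj_transpose A"
proof (rule eq_matI)
  fix i j
  assume "i < dim_row (conj_transpose B * conj_transpose A)"
    "j < dim_col (conj_transpose B * conj_transpose A)"
  then have ij: "i < n" "j < m"
    using A B by (simp_all add: conj_transpose_def)
  have "conj_transpose (A * B) $$ (i, j) = conjugate ((A * B) $$ (j, i))"
    using A B ij by (intro conj_transpose_entry) auto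
  also have "\<dots> = (\<Sum>k<l. conjugate (B $$ (k, i)) * conjugate (A $$ (j, k)))"
    using A B ij by (simp add: mult_mat_entry[of _ m l _ n] conjugate_sum conjugate_mult_rev del: index_mult_mat)
  also have "\<dots> = (\<Sum>k<l. conj_transpose B $$ (i, k) * conj_transpose A $$ (k, j))"
    using A B ij by (intro sum.cong) (simp_all add: conj_transpose_entry)
  also have "\<dots> = (conj_transpose B * conj_transpose A) $$ (i, j)"
    using A B ij by (intro mult_mat_entry[symmetric]) auto
  finally show "conj_transpose (A * B) $$ (i, j) = (conj_transpose B * conj_transpose A) $$ (i, j)" .
qed (use A B in \<open>simp_all add: conj_transpose_def\<close>)

lemma unitary_matD:
  assumes "unitary_mat n U"
  shows "U \<in> carrier_mat n n" "conj_transpose U \<in> carrier_mat n n"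
    "conj_transpose U * U = 1\<^sub>m n" "U * conj_transpose U = 1\<^sub>m n"
  using assms by (auto simp: unitary_mat_def)

lemma unitary_one: "unitary_mat n (1\<^sub>m n :: 'a::star_ring mat)"
  by (simp add: unitary_mat_def)

lemma unitary_conj_transpose: "unitary_mat n U \<Longrightarrow> unitary_mat n (conj_transpose U)"
  by (simp add: unitary_mat_def)

lemma mult_inverse_cancel:
  fixes A B C :: "'a::semiring_1 mat"
  assumes "A \<in> carrier_mat n n" "B \<in> carrier_mat n n" "A * B = 1\<^sub>m n" "C \<in> carrier_mat n l"
  shows "A * (B * C) = C"
  using assms by (metis assoc_mult_mat left_mult_one_mat)

lemma mult_inverse_cancel_right:
  fixes A B C :: "'a::semiring_1 mat"
  assumes "A \<in> carrier_mat n n" "B \<in> carrier_mat n n" "A * B = 1\<^sub>m n" "C \<in> carrier_mat l n"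
  shows "C * A * B = C"
  using assms by (metis assoc_mult_mat right_mult_one_mat)

lemma unitary_mult:
  fixes U V :: "'a::star_ring mat"
  assumes U: "unitary_mat n U" and V: "unitary_mat n V"
  shows "unitary_mat n (U * V)"
proof -
  note u = unitary_matD[OF U] and v = unitary_matD[OF V]
  have c: "conj_transpose (U * V) = conj_transpose V * conj_transpose U"
    by (rule conj_transpose_mult[OF u(1) v(1)])
  have "conj_transpose V * conj_transpose U * (U * V)
      = conj_transpose V * (conj_transpose U * (U * V))"
    using u v by (intro assoc_mult_mat) auto
  also have "\<dots> = 1\<^sub>m n"
    using mult_inverse_cancel[OF u(2) u(1) u(3) v(1)] v by simp
  finally have 1: "conj_transpose V * conj_transpose U * (U * V) = 1\<^sub>m n" .
  have "U * V * (conj_transpose V * conj_transpose U)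
      = U * (V * (conj_transpose V * conj_transpose U))"
    using u v by (intro assoc_mult_mat) auto
  also have "\<dots> = 1\<^sub>m n"
    using mult_inverse_cancel[OF v(1) v(2) v(4) u(2)] u by simp
  finally show ?thesis
    using 1 u v by (simp add: unitary_mat_def c)
qed

lemma conj_transpose_block_diag:
  fixes U V :: "'a::star_ring mat"
  assumes "U \<in> carrier_mat k k" "V \<in> carrier_mat n n"
  shows "conj_transpose (four_block_mat U (0\<^sub>m k n) (0\<^sub>m n k) V)
    = four_block_mat (conj_transpose U) (0\<^sub>m k n) (0\<^sub>m n k) (conj_transpose V)"
  using assms by (intro eq_matI) (auto simp: conj_transpose_def)

lemma unitary_block_diag:
  fixes U V :: "'a::star_ring mat"
  assumes U: "unitary_mat k U" and V: "unitary_mat n V"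
  shows "unitary_mat (k + n) (four_block_mat U (0\<^sub>m k n) (0\<^sub>m n k) V)"
proof -
  note u = unitary_matD[OF U] and v = unitary_matD[OF V]
  show ?thesis
    unfolding unitary_mat_def conj_transpose_block_diag[OF u(1) v(1)]
    using u v by (simp add: mult_four_block_mat[of _ k k _ n _ n _ _ k _ n])
qed

lemma permutation_mat_carrier: "permutation_mat n P \<Longrightarrow> P \<in> carrier_mat n n"
  by (auto simp: permutation_mat_def)

lemma permutation_one: "permutation_mat n (1\<^sub>m n)"
  unfolding permutation_mat_def by (rule exI[of _ id]) (auto intro!: eq_matI permutes_id)

lemma mult_permutation_entry:
  fixes B :: "'a::semiring_1 mat"
  assumes "B \<in> carrier_mat m n" "\<pi> permutes {..<n}" "i < m" "j < n"
  shows "(B * mat n n (\<lambda>(i, j). if i = \<pi> j then 1 else 0)) $$ (i, j) = B $$ (i, \<pi> j)"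
proof -
  have \<pi>: "\<pi> j < n"
    using permutes_in_image[OF assms(2), of j] assms(4) by simp
  have "(B * mat n n (\<lambda>(i, j). if i = \<pi> j then 1 else 0)) $$ (i, j)
      = (\<Sum>k<n. B $$ (i, k) * (if k = \<pi> j then 1 else 0))"
    using assms by (subst mult_mat_entry[of _ m n _ n]) auto
  also have "\<dots> = (\<Sum>k<n. if k = \<pi> j then B $$ (i, k) else 0)"
    by (intro sum.cong) auto
  finally have "(B * mat n n (\<lambda>(i, j). if i = \<pi> j then 1 else 0)) $$ (i, j)
      = (\<Sum>k<n. if k = \<pi> j then B $$ (i, k) else 0)" .
  then show ?thesis
    using \<pi> by simp
qed

lemma permutation_mult:
  fixes P Q :: "'a::semiring_1 mat"
  assumes "permutation_mat n P" "permutation_mat n Q"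
  shows "permutation_mat n (P * Q)"
proof -
  obtain \<pi> where \<pi>: "\<pi> permutes {..<n}" "P = mat n n (\<lambda>(i, j). if i = \<pi> j then 1 else 0)"
    using assms(1) by (auto simp: permutation_mat_def)
  obtain \<sigma> where \<sigma>: "\<sigma> permutes {..<n}" "Q = mat n n (\<lambda>(i, j). if i = \<sigma> j then 1 else 0)"
    using assms(2) by (auto simp: permutation_mat_def)
  have "P * Q = mat n n (\<lambda>(i, j). if i = (\<pi> \<circ> \<sigma>) j then 1 else 0)"
  proof (rule eq_matI)
    fix i j
    assume "i < dim_row (mat n n (\<lambda>(i, j). if i = (\<pi> \<circ> \<sigma>) j then 1 else 0 :: 'a))"
      "j < dim_col (mat n n (\<lambda>(i, j). if i = (\<pi> \<circ> \<sigma>) j then 1 else 0 :: 'a))"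
    then have ij: "i < n" "j < n"
      by simp_all
    moreover have "\<sigma> j < n"
      using permutes_in_image[OF \<sigma>(1), of j] ij by simp
    ultimately show "(P * Q) $$ (i, j)
        = mat n n (\<lambda>(i, j). if i = (\<pi> \<circ> \<sigma>) j then 1 else 0) $$ (i, j)"
      unfolding \<sigma>(2)
      using mult_permutation_entry[of P n n \<sigma> i j] \<sigma>(1) \<pi>(2) by simp
  qed (simp_all add: \<pi>(2) \<sigma>(2))
  then show ?thesis
    unfolding permutation_mat_def using permutes_compose[OF \<sigma>(1) \<pi>(1)] by blast
qed

lemma permutation_block_diag:
  fixes P :: "'a::semiring_1 mat"
  assumes "permutation_mat n P"
  shows "permutation_mat (Suc n) (four_block_mat (1\<^sub>m 1) (0\<^sub>m 1 n) (0\<^sub>m n 1) P)"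
proof -
  obtain \<pi> where \<pi>: "\<pi> permutes {..<n}" "P = mat n n (\<lambda>(i, j). if i = \<pi> j then 1 else 0)"
    using assms by (auto simp: permutation_mat_def)
  define \<rho> where "\<rho> j = (case j of 0 \<Rightarrow> 0 | Suc l \<Rightarrow> Suc (\<pi> l))" for j
  have inj: "inj_on \<rho> {..<Suc n}"
    by (rule inj_onI)
      (auto simp: \<rho>_def split: nat.splits dest: injD[OF permutes_inj[OF \<pi>(1)]])
  have "\<rho> j < Suc n" if "j < Suc n" for j
    using that permutes_in_image[OF \<pi>(1), of "j - 1"] by (cases j) (simp_all add: \<rho>_def)
  then have "\<rho> ` {..<Suc n} \<subseteq> {..<Suc n}"
    by auto
  then have "bij_betw \<rho> {..<Suc n} {..<Suc n}"
    using inj by (simp add: bij_betw_def endo_inj_surj)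
  moreover have "\<rho> j = j" if "j \<notin> {..<Suc n}" for j
    using that permutes_not_in[OF \<pi>(1), of "j - 1"] by (cases j) (simp_all add: \<rho>_def)
  ultimately have "\<rho> permutes {..<Suc n}"
    by (intro bij_imp_permutes) auto
  moreover have "four_block_mat (1\<^sub>m 1) (0\<^sub>m 1 n) (0\<^sub>m n 1) P
      = mat (Suc n) (Suc n) (\<lambda>(i, j). if i = \<rho> j then 1 else 0)"
    by (rule eq_matI) (auto simp: \<pi>(2) \<rho>_def split: nat.splits)
  ultimately show ?thesis
    unfolding permutation_mat_def by blast
qed

lemma permutation_transpose_exists:
  assumes "c < n" "0 < n"
  obtains P :: "'a::semiring_1 mat" where "permutation_mat n P"
    "\<And>(B :: 'a mat) m i. B \<in> carrier_mat m n \<Longrightarrow> i < m \<Longrightarrow> (B * P) $$ (i, 0) = B $$ (i, c)"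
proof -
  have t: "Transposition.transpose 0 c permutes {..<n}"
    using assms by (intro permutes_swap_id) auto
  show ?thesis
  proof (rule that)
    show "permutation_mat n (mat n n (\<lambda>(i, j). if i = Transposition.transpose 0 c j then 1 else 0 :: 'a))"
      unfolding permutation_mat_def using t by blast
  next
    fix B :: "'a mat" and m i
    assume "B \<in> carrier_mat m n" "i < m"
    then show "(B * mat n n (\<lambda>(i, j). if i = Transposition.transpose 0 c j then 1 else 0)) $$ (i, 0)
        = B $$ (i, c)"
      using mult_permutation_entry[OF _ t, of B m i 0] assms by simp
  qed
qed

section \<open>Quaternion norms and standard parts\<close>

definition quat_normsq :: "quat \<Rightarrow> real" where
  "quat_normsq q = (qre q)\<^sup>2 + (qi q)\<^sup>2 + (qj q)\<^sup>2 + (qk q)\<^sup>2"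

lemma of_real_quat: "(of_real c :: quat) = Quat c 0 0 0"
  by (simp add: of_real_def scaleR_quat_def one_quat_def)

lemma conjugate_mult_self: "conjugate q * q = of_real (quat_normsq q)"
  by (simp add: quat_eq_iff of_real_quat conjugate_quat_def times_quat_def quat_normsq_def
      power2_eq_square algebra_simps)

lemma mult_conjugate_self: "q * conjugate q = of_real (quat_normsq q)"
  by (simp add: quat_eq_iff of_real_quat conjugate_quat_def times_quat_def quat_normsq_def
      power2_eq_square algebra_simps)

lemma conjugate_of_real [simp]: "conjugate (of_real c :: quat) = of_real c"
  by (simp add: of_real_quat conjugate_quat_def)

lemma conjugate_scaleR: "conjugate (c *\<^sub>R q) = c *\<^sub>R conjugate (q :: quat)"
  by (simp add: quat_eq_iff conjugate_quat_def scaleR_quat_def)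

lemma quat_normsq_nonneg: "0 \<le> quat_normsq q"
  by (simp add: quat_normsq_def)

lemma quat_normsq_eq_0_iff: "quat_normsq q = 0 \<longleftrightarrow> q = 0"
  by (auto simp: quat_normsq_def quat_eq_iff zero_quat_def add_nonneg_eq_0_iff)

lemma quat_no_zero_divisors:
  fixes p q :: quat
  assumes "p * q = 0" "q \<noteq> 0"
  shows "p = 0"
proof -
  have "p * q * conjugate q = 0"
    using assms(1) by simp
  then have "quat_normsq q *\<^sub>R p = 0"
    by (simp add: mult.assoc mult_conjugate_self of_real_def)
  then show ?thesis
    using assms(2) quat_normsq_eq_0_iff by simp
qed

lemma st_simps [simp]:
  "st 0 = 0" "st 1 = 1" "st (x + y) = st x + st y" "st (x * y) = st x * st y"
  by (simp_all add: zero_dual_def one_dual_def plus_dual_def times_dual_def)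

lemma inf_part_simps [simp]:
  "inf_part 0 = 0" "inf_part 1 = 0" "inf_part (x + y) = inf_part x + inf_part y"
  "inf_part (x * y) = st x * inf_part y + inf_part x * st y"
  by (simp_all add: zero_dual_def one_dual_def plus_dual_def times_dual_def)

lemma st_sum: "st (sum f I) = (\<Sum>i\<in>I. st (f i))"
  by (induction I rule: infinite_finite_induct) simp_all

lemma inf_part_sum: "inf_part (sum f I) = (\<Sum>i\<in>I. inf_part (f i))"
  by (induction I rule: infinite_finite_induct) simp_all

interpretation st_hom: semiring_hom "st :: 'a::ring_1 dual \<Rightarrow> 'a"
  by standard simp_all

lemma st_conjugate [simp]: "st (conjugate x) = conjugate (st x)"
  by (simp add: conjugate_dual_def)

lemma st_conj_transpose: "map_mat st (conj_transpose A) = conj_transpose (map_mat st A)"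
  by (rule eq_matI) (simp_all add: conj_transpose_def)

lemma unitary_st:
  fixes U :: "'a::star_ring dual mat"
  assumes "unitary_mat n U"
  shows "unitary_mat n (map_mat st U)"
proof -
  note u = unitary_matD[OF assms]
  have "conj_transpose (map_mat st U) * map_mat st U = map_mat st (1\<^sub>m n)"
    by (metis st_conj_transpose st_hom.mat_hom_mult u(1,2,3))
  moreover have "map_mat st U * conj_transpose (map_mat st U) = map_mat st (1\<^sub>m n)"
    by (metis st_conj_transpose st_hom.mat_hom_mult u(1,2,4))
  ultimately show ?thesis
    using u(1) by (simp add: unitary_mat_def st_hom.mat_hom_one)
qed

section \<open>Householder reflections\<close>

text \<open>The reflection \<open>I - s v v\<^sup>*\<close> is Hermitian, and since \<open>v\<^sup>* v = c\<close> is real, hence central, its square is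
  \<open>I - (2 s - s\<^sup>2 c) v v\<^sup>*\<close>.\<close>

lemma householder_unitary:
  fixes v :: "nat \<Rightarrow> quat"
  assumes c: "c = (\<Sum>k<m. quat_normsq (v k))" and s: "s * c = 2"
  shows "unitary_mat m (mat m m (\<lambda>(i, j). (if i = j then 1 else 0) - s *\<^sub>R (v i * conjugate (v j))))"
    (is "unitary_mat m ?H")
proof -
  define h where "h i j = (if i = j then 1 else 0) - s *\<^sub>R (v i * conjugate (v j))" for i j
  have vv: "(\<Sum>k<m. conjugate (v k) * v k) = of_real c"
    by (simp add: c conjugate_mult_self)
  have hh: "(\<Sum>k<m. h i k * h k j) = (if i = j then 1 else 0)" if "i < m" "j < m" for i j
  proof -
    have "h i k * h k j = (if i = k then h k j else 0) - (if k = j then s *\<^sub>R (v i * conjugate (v k)) else 0)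
        + (s * s) *\<^sub>R (v i * (conjugate (v k) * v k) * conjugate (v j))" for k
      by (simp add: h_def algebra_simps)
    then have "(\<Sum>k<m. h i k * h k j) = h i j - s *\<^sub>R (v i * conjugate (v j))
        + (s * s) *\<^sub>R (v i * (\<Sum>k<m. conjugate (v k) * v k) * conjugate (v j))"
      using that by (simp add: sum.distrib sum_subtractf scaleR_sum_right sum_distrib_left sum_distrib_right)
    also have "\<dots> = h i j - s *\<^sub>R (v i * conjugate (v j)) + (s * (s * c)) *\<^sub>R (v i * conjugate (v j))"
      by (simp add: vv of_real_def)
    also have "s * (s * c) = s + s"
      by (simp add: s)
    finally have "(\<Sum>k<m. h i k * h k j) = (if i = j then 1 else 0)"
      by (simp only: scaleR_add_left) (simp add: h_def)
    then show ?thesis .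
  qed
  have adj: "conj_transpose ?H = ?H"
    by (rule eq_matI)
      (simp_all add: conj_transpose_def conjugate_minus conjugate_scaleR conjugate_mult_rev)
  have "?H * ?H = 1\<^sub>m m"
  proof (rule eq_matI)
    fix i j
    assume "i < dim_row (1\<^sub>m m :: quat mat)" "j < dim_col (1\<^sub>m m :: quat mat)"
    then have ij: "i < m" "j < m"
      by simp_all
    then have "(?H * ?H) $$ (i, j) = (\<Sum>k<m. h i k * h k j)"
      by (subst mult_mat_entry[of _ m m _ m]) (simp_all add: h_def)
    then show "(?H * ?H) $$ (i, j) = 1\<^sub>m m $$ (i, j)"
      using ij hh by simp
  qed simp_all
  then show ?thesis
    unfolding unitary_mat_def adj by simp
qed

text \<open>The sign in the choice of the Householder target: a negative multiple of the direction of \<open>x\<close> makes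
  \<open>a\<^sup>* x\<close> real and nonpositive. Realness is what replaces commutativity in the reflection formula,
  and nonpositivity keeps the difference \<open>x - a\<close> away from zero unless \<open>x = 0\<close> and \<open>t = 0\<close>.\<close>

lemma quat_opposite_phase:
  assumes "0 \<le> t"
  obtains a b where "quat_normsq a = t\<^sup>2" "conjugate a * x = of_real b" "b \<le> 0"
proof (cases "x = 0")
  case True
  moreover have "quat_normsq (of_real t) = t\<^sup>2"
    by (simp add: quat_normsq_def of_real_quat)
  ultimately show ?thesis
    using that[of "of_real t" 0] by simp
next
  case False
  define n where "n = sqrt (quat_normsq x)"
  have n: "0 < n" "n\<^sup>2 = quat_normsq x"
    using False quat_normsq_nonneg[of x] quat_normsq_eq_0_iff[of x] by (auto simp: n_def less_le)
  show ?thesis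
  proof (rule that[of "(- t / n) *\<^sub>R x" "- t / n * quat_normsq x"])
    have "quat_normsq ((- t / n) *\<^sub>R x) = (- t / n)\<^sup>2 * quat_normsq x"
      by (simp add: quat_normsq_def scaleR_quat_def power_mult_distrib distrib_left power_divide)
    then show "quat_normsq ((- t / n) *\<^sub>R x) = t\<^sup>2"
      using n(1) by (simp add: power_divide n(2)[symmetric])
    show "conjugate ((- t / n) *\<^sub>R x) * x = of_real (- t / n * quat_normsq x)"
      by (simp add: conjugate_uminus conjugate_scaleR conjugate_mult_self of_real_def del: of_real_mult)
    show "- t / n * quat_normsq x \<le> 0"
      using n assms quat_normsq_nonneg[of x] by (simp add: divide_nonneg_pos)
  qed
qed

text \<open>For \<open>x \<noteq> 0\<close> and \<open>v = x - a e\<^sub>0\<close> with \<open>\<bar>a\<bar> = \<bar>x\<bar>\<close> and \<open>a\<^sup>* x\<^sub>0 = b\<close> real, both \<open>v\<^sup>* x = \<bar>x\<bar>\<^sup>2 - b\<close> and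
  \<open>v\<^sup>* v = 2 (\<bar>x\<bar>\<^sup>2 - b)\<close> hold, so the reflection along \<open>v\<close> maps \<open>x\<close> to \<open>x - v = a e\<^sub>0\<close>.\<close>

lemma unitary_quat_eliminate:
  fixes x :: "nat \<Rightarrow> quat"
  obtains U where "unitary_mat m U" "\<And>i. 0 < i \<Longrightarrow> i < m \<Longrightarrow> (\<Sum>k<m. U $$ (i, k) * x k) = 0"
proof (cases "\<forall>k<m. x k = 0")
  case True
  then show ?thesis
    using that[OF unitary_one] by simp
next
  case False
  then obtain k0 where k0: "k0 < m" "x k0 \<noteq> 0"
    by blast
  then have m: "0 < m"
    by simp
  define N where "N = (\<Sum>k<m. quat_normsq (x k))"
  have "quat_normsq (x k0) \<le> N"
    unfolding N_def using k0 by (intro member_le_sum) (auto simp: quat_normsq_nonneg)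
  then have N: "0 < N"
    using k0 quat_normsq_nonneg[of "x k0"] quat_normsq_eq_0_iff[of "x k0"] by linarith
  obtain a b where a: "quat_normsq a = N" "conjugate a * x 0 = of_real b" "b \<le> 0"
    using quat_opposite_phase[of "sqrt N" "x 0"] N by auto
  define v where "v k = x k - (if k = 0 then a else 0)" for k
  have "conjugate (x 0) * a = conjugate (conjugate a * x 0)"
    by (simp add: conjugate_mult_rev)
  then have xa: "conjugate (x 0) * a = of_real b"
    by (simp add: a(2))
  \<comment> \<open>The two inner products of the reflection formula.\<close>
  have "(\<Sum>k<m. conjugate (v k) * x k)
      = (\<Sum>k<m. conjugate (x k) * x k - (if k = 0 then conjugate a * x k else 0))"
    by (intro sum.cong) (simp_all add: v_def conjugate_minus left_diff_distrib)
  then have vx: "(\<Sum>k<m. conjugate (v k) * x k) = of_real (N - b)"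
    using m by (simp add: sum_subtractf conjugate_mult_self N_def a(2))
  have "(of_real (\<Sum>k<m. quat_normsq (v k)) :: quat) = (\<Sum>k<m. conjugate (v k) * v k)"
    by (simp add: conjugate_mult_self)
  also have "\<dots> = (\<Sum>k<m. conjugate (v k) * x k - (if k = 0 then conjugate (v k) * a else 0))"
    by (intro sum.cong) (simp_all add: v_def right_diff_distrib)
  also have "\<dots> = of_real (N - b) - (conjugate (x 0) - conjugate a) * a"
    using m by (simp add: sum_subtractf vx) (simp add: v_def conjugate_minus)
  also have "\<dots> = of_real ((N - b) - (b - N))"
    by (simp only: left_diff_distrib xa conjugate_mult_self a(1) of_real_diff)
  also have "(N - b) - (b - N) = 2 * (N - b)"
    by simp
  finally have c: "2 * (N - b) = (\<Sum>k<m. quat_normsq (v k))"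
    by (simp only: of_real_eq_iff)
  define s where "s = 1 / (N - b)"
  have s: "s * (2 * (N - b)) = 2" "s * (N - b) = 1"
    using N a(3) by (simp_all add: s_def field_simps)
  show ?thesis
  proof (rule that[OF householder_unitary[OF c s(1)]])
    fix i
    assume i: "0 < i" "i < m"
    have "(\<Sum>k<m. ((if i = k then 1 else 0) - s *\<^sub>R (v i * conjugate (v k))) * x k)
        = (\<Sum>k<m. (if i = k then x k else 0) - s *\<^sub>R (v i * (conjugate (v k) * x k)))"
      by (intro sum.cong) (simp_all add: left_diff_distrib mult.assoc)
    also have "\<dots> = x i - s *\<^sub>R (v i * (\<Sum>k<m. conjugate (v k) * x k))"
      using i by (simp add: sum_subtractf sum_distrib_left scaleR_sum_right)
    also have "\<dots> = x i - (s * (N - b)) *\<^sub>R v i"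
      by (simp add: vx of_real_def del: of_real_diff)
    also have "\<dots> = 0"
      using i by (simp only: s(2)) (simp add: v_def)
    finally show "(\<Sum>k<m. mat m m (\<lambda>(i, j). (if i = j then 1 else 0)
        - s *\<^sub>R (v i * conjugate (v j))) $$ (i, k) * x k) = 0"
      using i by simp
  qed
qed

section \<open>Unitary elimination over the dual quaternions\<close>

definition dual_mat :: "'a mat \<Rightarrow> 'a mat \<Rightarrow> 'a dual mat" where
  "dual_mat A B = mat (dim_row A) (dim_col A) (\<lambda>ij. Dual (A $$ ij) (B $$ ij))"

lemma dual_mat_carrier [simp]: "dual_mat A B \<in> carrier_mat m n \<longleftrightarrow> A \<in> carrier_mat m n"
  unfolding carrier_mat_def by (simp add: dual_mat_def)

lemma dual_mat_entry [simp]: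
  "A \<in> carrier_mat m n \<Longrightarrow> i < m \<Longrightarrow> j < n \<Longrightarrow> dual_mat A B $$ (i, j) = Dual (A $$ (i, j)) (B $$ (i, j))"
  by (auto simp: dual_mat_def)

lemma dual_mat_mult:
  fixes A B C D :: "'a::ring_1 mat"
  assumes "A \<in> carrier_mat m l" "B \<in> carrier_mat m l" "C \<in> carrier_mat l n" "D \<in> carrier_mat l n"
  shows "dual_mat A B * dual_mat C D = dual_mat (A * C) (A * D + B * C)"
proof (rule eq_matI)
  fix i j
  assume "i < dim_row (dual_mat (A * C) (A * D + B * C))" "j < dim_col (dual_mat (A * C) (A * D + B * C))"
  then have ij: "i < m" "j < n"
    using assms by (simp_all add: dual_mat_def)
  have "A * C \<in> carrier_mat m n"
    using assms by simp
  note entry = dual_mat_entry[OF this ij]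
  have "(A * D + B * C) $$ (i, j) = (A * D) $$ (i, j) + (B * C) $$ (i, j)"
    using assms ij by simp
  moreover have "(dual_mat A B * dual_mat C D) $$ (i, j)
      = (\<Sum>k<l. dual_mat A B $$ (i, k) * dual_mat C D $$ (k, j))"
    using assms ij by (intro mult_mat_entry) simp_all
  ultimately show "(dual_mat A B * dual_mat C D) $$ (i, j) = dual_mat (A * C) (A * D + B * C) $$ (i, j)"
    using assms ij
    by (simp add: dual_eq_iff st_sum inf_part_sum sum.distrib mult_mat_entry[of _ m l _ n] entry
        del: index_mult_mat)
qed (use assms in \<open>simp_all add: dual_mat_def\<close>)

lemma dual_mat_conj_transpose:
  "A \<in> carrier_mat m n \<Longrightarrow> B \<in> carrier_mat m n \<Longrightarrow>
    conj_transpose (dual_mat A B) = dual_mat (conj_transpose A) (conj_transpose B)"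
  by (rule eq_matI) (auto simp: conj_transpose_def dual_mat_def conjugate_dual_def)

lemma dual_mat_one: "dual_mat (1\<^sub>m n) (0\<^sub>m n n) = (1\<^sub>m n :: 'a::ring_1 dual mat)"
  by (rule eq_matI) (auto simp: dual_mat_def one_dual_def zero_dual_def)

lemma unitary_dual_mat:
  fixes U :: "'a::star_ring mat"
  assumes "unitary_mat n U"
  shows "unitary_mat n (dual_mat U (0\<^sub>m n n))"
proof -
  note u = unitary_matD[OF assms]
  have "conj_transpose (0\<^sub>m n n) = (0\<^sub>m n n :: 'a mat)"
    by (rule eq_matI) (simp_all add: conj_transpose_def)
  then show ?thesis
    unfolding unitary_mat_def using u
    by (simp add: dual_mat_conj_transpose[OF u(1)] dual_mat_mult[of _ n n _ _ n] dual_mat_one)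
qed

text \<open>Since \<open>\<epsilon>\<^sup>2 = 0\<close>, the product of \<open>I + K \<epsilon>\<close> and its adjoint \<open>I - K \<epsilon>\<close> is \<open>I\<close>: skew-Hermitian matrices
  are the tangent directions of the unitary group at the identity.\<close>

lemma unitary_one_plus_skew:
  fixes K :: "'a::star_ring mat"
  assumes K: "K \<in> carrier_mat n n" and skew: "conj_transpose K = - K"
  shows "unitary_mat n (dual_mat (1\<^sub>m n) K)"
proof -
  have KK: "K + - K = 0\<^sub>m n n" "- K + K = 0\<^sub>m n n"
    using K by (auto simp: mat_eq_iff)
  have mK: "- K \<in> carrier_mat n n"
    using K by simp
  show ?thesis
    unfolding unitary_mat_def dual_mat_conj_transpose[OF one_carrier_mat K] skew conj_transpose_one
      dual_mat_mult[OF one_carrier_mat mK one_carrier_mat K]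
      dual_mat_mult[OF one_carrier_mat K one_carrier_mat mK]
    using K mK by (simp add: KK dual_mat_one)
qed

lemma mult_mult_column:
  fixes U V :: "'a::semiring_0 mat"
  assumes "U \<in> carrier_mat m m" "V \<in> carrier_mat m m" "i < m"
  shows "(\<Sum>k<m. (U * V) $$ (i, k) * x k) = (\<Sum>j<m. U $$ (i, j) * (\<Sum>k<m. V $$ (j, k) * x k))"
proof -
  have "(\<Sum>k<m. (U * V) $$ (i, k) * x k) = (\<Sum>k<m. \<Sum>j<m. U $$ (i, j) * V $$ (j, k) * x k)"
    using assms by (intro sum.cong) (simp_all add: mult_mat_entry[of _ m m _ m] sum_distrib_right del: index_mult_mat)
  also have "\<dots> = (\<Sum>j<m. \<Sum>k<m. U $$ (i, j) * V $$ (j, k) * x k)"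
    by (rule sum.swap)
  finally show ?thesis
    by (simp add: sum_distrib_left mult.assoc)
qed

text \<open>The infinitesimal correction only sees the standard part \<open>(a, 0, ..., 0)\<close> of \<open>z\<close>, so the first
  column of \<open>K\<close> can be chosen to cancel the infinitesimal parts below the first entry; the first row
  of \<open>K\<close> is then forced by skewness and affects only the first entry.\<close>

lemma unitary_skew_eliminate:
  fixes z :: "nat \<Rightarrow> dquat"
  assumes z0: "st (z 0) \<noteq> 0" and zi: "\<And>i. 0 < i \<Longrightarrow> i < m \<Longrightarrow> st (z i) = 0"
  obtains W where "unitary_mat m W" "\<And>i. 0 < i \<Longrightarrow> i < m \<Longrightarrow> (\<Sum>k<m. W $$ (i, k) * z k) = 0"
proof -
  define a where "a = st (z 0)"
  \<comment> \<open>The quaternion \<open>w i\<close> is \<open>inf_part (z i)\<close> times the inverse of \<open>a\<close>.\<close>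
  define w where "w i = (1 / quat_normsq a) *\<^sub>R (inf_part (z i) * conjugate a)" for i
  have wa: "w i * a = inf_part (z i)" for i
    using z0 quat_normsq_eq_0_iff[of a]
    by (simp add: w_def a_def mult.assoc conjugate_mult_self of_real_def)
  define K where "K = mat m m (\<lambda>(i, j). if i = 0 \<and> j \<noteq> 0 then conjugate (w j)
    else if j = 0 \<and> i \<noteq> 0 then - w i else 0)"
  have K: "K \<in> carrier_mat m m"
    by (simp add: K_def)
  have "conj_transpose K = - K"
    by (rule eq_matI) (auto simp: conj_transpose_def K_def conjugate_uminus)
  note unitary = unitary_one_plus_skew[OF K this]
  show ?thesis
  proof (rule that[OF unitary])
    fix i
    assume i: "0 < i" "i < m"
    have Kz: "K $$ (i, k) * st (z k) = (if k = 0 then - w i * a else 0)" if "k < m" for k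
      using that i by (simp add: K_def a_def)
    have e: "dual_mat (1\<^sub>m m) K $$ (i, k) = Dual (if i = k then 1 else 0) (K $$ (i, k))" if "k < m" for k
      using that i by (subst dual_mat_entry[of _ m m]) simp_all
    have "st (\<Sum>k<m. dual_mat (1\<^sub>m m) K $$ (i, k) * z k) = (\<Sum>k<m. if i = k then st (z k) else 0)"
      unfolding st_sum by (intro sum.cong) (simp_all add: e)
    then have 1: "st (\<Sum>k<m. dual_mat (1\<^sub>m m) K $$ (i, k) * z k) = 0"
      using i zi by simp
    have "inf_part (\<Sum>k<m. dual_mat (1\<^sub>m m) K $$ (i, k) * z k)
        = (\<Sum>k<m. (if i = k then inf_part (z k) else 0) + (if k = 0 then - w i * a else 0))"
      unfolding inf_part_sum
    proof (rule sum.cong)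
      fix k
      assume "k \<in> {..<m}"
      then have k: "k < m"
        by simp
      show "inf_part (dual_mat (1\<^sub>m m) K $$ (i, k) * z k)
          = (if i = k then inf_part (z k) else 0) + (if k = 0 then - w i * a else 0)"
        unfolding e[OF k] by (simp add: Kz[OF k])
    qed simp
    also have "\<dots> = 0"
      using i by (simp add: sum.distrib wa)
    finally show "(\<Sum>k<m. dual_mat (1\<^sub>m m) K $$ (i, k) * z k) = 0"
      using 1 by (simp add: dual_eq_iff)
  qed
qed

text \<open>Eliminating the standard part first leaves only infinitesimal entries below the first one. These are
  either small against an appreciable first entry, or part of a column \<open>y \<epsilon>\<close> on which a unitary
  quaternion matrix acts as it does on \<open>y\<close>.\<close>

lemma unitary_eliminate:
  fixes x :: "nat \<Rightarrow> dquat"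
  obtains U where "unitary_mat m U" "\<And>i. 0 < i \<Longrightarrow> i < m \<Longrightarrow> (\<Sum>k<m. U $$ (i, k) * x k) = 0"
proof -
  obtain U0 where U0: "unitary_mat m U0"
      "\<And>i. 0 < i \<Longrightarrow> i < m \<Longrightarrow> (\<Sum>k<m. U0 $$ (i, k) * st (x k)) = 0"
    using unitary_quat_eliminate[of m "\<lambda>k. st (x k)"] by blast
  define U1 where "U1 = dual_mat U0 (0\<^sub>m m m)"
  define z where "z j = (\<Sum>k<m. U1 $$ (j, k) * x k)" for j
  have U1: "unitary_mat m U1"
    unfolding U1_def by (rule unitary_dual_mat[OF U0(1)])
  have lift: "dual_mat V (0\<^sub>m m m) $$ (i, k) = Dual (V $$ (i, k)) 0"
    if "unitary_mat m V" "i < m" "k < m" for V :: "quat mat" and i k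
    using that unitary_matD(1)[OF that(1)] by (subst dual_mat_entry[of _ m m]) simp_all
  have z: "st (z i) = 0" if "0 < i" "i < m" for i
    using that U0(2)[OF that] by (simp add: z_def U1_def st_sum lift[OF U0(1)])
  obtain W where W: "unitary_mat m W" "\<And>i. 0 < i \<Longrightarrow> i < m \<Longrightarrow> (\<Sum>k<m. W $$ (i, k) * z k) = 0"
  proof (cases "st (z 0) = 0")
    case False
    then show ?thesis
      using unitary_skew_eliminate[of z m] z that by blast
  next
    case True
    obtain V where V: "unitary_mat m V"
        "\<And>i. 0 < i \<Longrightarrow> i < m \<Longrightarrow> (\<Sum>k<m. V $$ (i, k) * inf_part (z k)) = 0"
      using unitary_quat_eliminate[of m "\<lambda>k. inf_part (z k)"] by blast
    have z': "st (z k) = 0" if "k < m" for k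
      using True z[of k] that by (cases "k = 0") auto
    show ?thesis
    proof (rule that[OF unitary_dual_mat[OF V(1)]])
      fix i
      assume i: "0 < i" "i < m"
      then show "(\<Sum>k<m. dual_mat V (0\<^sub>m m m) $$ (i, k) * z k) = 0"
        using V(2)[OF i] by (simp add: dual_eq_iff st_sum inf_part_sum lift[OF V(1)] z')
    qed
  qed
  show ?thesis
  proof (rule that[OF unitary_mult[OF W(1) U1]])
    fix i
    assume i: "0 < i" "i < m"
    then show "(\<Sum>k<m. (W * U1) $$ (i, k) * x k) = 0"
      using mult_mult_column[of W m U1 i x] unitary_matD(1)[OF W(1)] unitary_matD(1)[OF U1] W(2)[OF i]
      by (simp add: z_def)
  qed
qed

section \<open>Pivoted QR decomposition\<close>

text \<open>The pivoting is what makes the rows from \<open>k\<close> on infinitesimal: a column with infinitesimal pivot is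
  accepted only when the whole remaining block is infinitesimal, and multiplication by unitary
  matrices keeps it so.\<close>

lemma pivoted_qr:
  fixes B :: "dquat mat"
  assumes "B \<in> carrier_mat m n"
  shows "\<exists>P U k. permutation_mat n P \<and> unitary_mat m U \<and> upper_trapezoidal (U * B * P) \<and>
    k \<le> m \<and> k \<le> n \<and> (\<forall>i<k. st ((U * B * P) $$ (i, i)) \<noteq> 0) \<and>
    (\<forall>i j. k \<le> i \<longrightarrow> i < m \<longrightarrow> j < n \<longrightarrow> st ((U * B * P) $$ (i, j)) = 0)"
  using assms
proof (induction m arbitrary: n B)
  case 0
  then have "upper_trapezoidal (1\<^sub>m 0 * B * 1\<^sub>m n)"
    by (simp add: upper_trapezoidal_def)
  then show ?case
    using permutation_one[of n] unitary_one[of 0] by (intro exI[of _ "1\<^sub>m n"] exI[of _ "1\<^sub>m 0"] exI[of _ 0]) simp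
next
  case (Suc m)
  note B = Suc.prems
  show ?case
  proof (cases n)
    case 0
    then have "upper_trapezoidal (1\<^sub>m (Suc m) * B * 1\<^sub>m n)"
      by (simp add: upper_trapezoidal_def)
    then show ?thesis
      using permutation_one[of n] unitary_one[of "Suc m"] 0
      by (intro exI[of _ "1\<^sub>m n"] exI[of _ "1\<^sub>m (Suc m)"] exI[of _ 0]) simp
  next
    case n: (Suc n')
    \<comment> \<open>The pivot column; the choice is arbitrary if the block is infinitesimal.\<close>
    obtain c where c: "c < n" "(\<forall>i<Suc m. st (B $$ (i, c)) = 0) \<Longrightarrow> (\<forall>i<Suc m. \<forall>j<n. st (B $$ (i, j)) = 0)"
    proof (cases "\<exists>i<Suc m. \<exists>j<n. st (B $$ (i, j)) \<noteq> 0")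
      case True
      then show ?thesis
        using that by blast
    next
      case False
      then show ?thesis
        using that[of 0] n by auto
    qed
    obtain P1 :: "dquat mat" where P1: "permutation_mat n P1"
      "\<And>(B :: dquat mat) m i. B \<in> carrier_mat m n \<Longrightarrow> i < m \<Longrightarrow> (B * P1) $$ (i, 0) = B $$ (i, c)"
      using permutation_transpose_exists[OF c(1)] n by blast
    note P1c = permutation_mat_carrier[OF P1(1)]
    obtain U1 where U1: "unitary_mat (Suc m) U1"
      "\<And>i. 0 < i \<Longrightarrow> i < Suc m \<Longrightarrow> (\<Sum>k<Suc m. U1 $$ (i, k) * (B * P1) $$ (k, 0)) = 0"
      using unitary_eliminate[of "Suc m" "\<lambda>k. (B * P1) $$ (k, 0)"] by blast
    note U1c = unitary_matD[OF U1(1)]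
    have BP: "B * P1 \<in> carrier_mat (Suc m) n"
      using B P1c by simp
    define C where "C = U1 * (B * P1)"
    have C: "C \<in> carrier_mat (Suc m) n"
      using U1c(1) BP by (simp add: C_def)
    have C0: "C $$ (i, 0) = 0" if "0 < i" "i < Suc m" for i
      unfolding C_def using U1(2)[OF that] that n
      by (subst mult_mat_entry[OF U1c(1) BP]) simp_all
    define a where "a = mat 1 1 (\<lambda>_. C $$ (0, 0))"
    define b where "b = mat 1 n' (\<lambda>(i, j). C $$ (0, Suc j))"
    define D where "D = mat m n' (\<lambda>(i, j). C $$ (Suc i, Suc j))"
    have abD: "a \<in> carrier_mat 1 1" "b \<in> carrier_mat 1 n'" "D \<in> carrier_mat m n'"
      by (simp_all add: a_def b_def D_def)
    have Cblock: "C = four_block_mat a b (0\<^sub>m m 1) D"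
      using C n by (intro eq_matI) (auto simp: a_def b_def D_def C0)
    obtain P' U' k' where IH: "permutation_mat n' P'" "unitary_mat m U'"
      "upper_trapezoidal (U' * D * P')" "k' \<le> m" "k' \<le> n'"
      "\<forall>i<k'. st ((U' * D * P') $$ (i, i)) \<noteq> 0"
      "\<forall>i j. k' \<le> i \<longrightarrow> i < m \<longrightarrow> j < n' \<longrightarrow> st ((U' * D * P') $$ (i, j)) = 0"
      using Suc.IH[OF abD(3)] by blast
    note P'c = permutation_mat_carrier[OF IH(1)] and U'c = unitary_matD[OF IH(2)]
    define U2 where "U2 = four_block_mat (1\<^sub>m 1) (0\<^sub>m 1 m) (0\<^sub>m m 1) U'"
    define P2 where "P2 = four_block_mat (1\<^sub>m 1) (0\<^sub>m 1 n') (0\<^sub>m n' 1) P'"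
    have U2: "unitary_mat (Suc m) U2"
      using unitary_block_diag[OF unitary_one[of 1] IH(2)] by (simp add: U2_def)
    have P2: "permutation_mat n P2"
      unfolding n P2_def by (rule permutation_block_diag[OF IH(1)])
    note U2c = unitary_matD[OF U2] and P2c = permutation_mat_carrier[OF P2]
    define U where "U = U2 * U1"
    define P where "P = P1 * P2"
    define R where "R = U * B * P"
    have U: "unitary_mat (Suc m) U"
      unfolding U_def by (rule unitary_mult[OF U2 U1(1)])
    have P: "permutation_mat n P"
      unfolding P_def by (rule permutation_mult[OF P1(1) P2])
    have "R = U2 * C * P2"
    proof -
      have "R = U2 * U1 * B * (P1 * P2)"
        by (simp add: R_def U_def P_def)
      also have "\<dots> = U2 * U1 * B * P1 * P2"
        using U2c U1c B P1c P2c by (intro assoc_mult_mat[symmetric]) auto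
      also have "U2 * U1 * B * P1 = U2 * U1 * (B * P1)"
        using U2c U1c B P1c by (intro assoc_mult_mat) auto
      also have "\<dots> = U2 * C"
        unfolding C_def using U2c U1c BP by (intro assoc_mult_mat) auto
      finally show ?thesis .
    qed
    also have "U2 * C = four_block_mat a b (0\<^sub>m m 1) (U' * D)"
      unfolding U2_def Cblock using abD U'c
      by (subst mult_four_block_mat[of _ 1 1 _ m _ m _ _ 1 _ n']) simp_all
    also have "\<dots> * P2 = four_block_mat a (b * P') (0\<^sub>m m 1) (U' * D * P')"
      unfolding P2_def using abD U'c P'c
      by (subst mult_four_block_mat[of _ 1 1 _ n' _ m _ _ 1 _ n']) simp_all
    finally have R: "R = four_block_mat a (b * P') (0\<^sub>m m 1) (U' * D * P')" .
    define E where "E = U' * D * P'"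
    have E: "E \<in> carrier_mat m n'"
      using abD U'c P'c by (simp add: E_def)
    have R00: "R $$ (0, 0) = C $$ (0, 0)"
      and Ri0: "\<And>i. i < m \<Longrightarrow> R $$ (Suc i, 0) = 0"
      and Rij: "\<And>i j. i < m \<Longrightarrow> j < n' \<Longrightarrow> R $$ (Suc i, Suc j) = E $$ (i, j)"
      using abD E P'c unfolding R E_def[symmetric] by (simp_all add: a_def)
    have Rc: "R \<in> carrier_mat (Suc m) n"
      using unitary_matD(1)[OF U] B permutation_mat_carrier[OF P] by (simp add: R_def)
    have trap: "upper_trapezoidal R"
      unfolding upper_trapezoidal_def
    proof (intro allI impI)
      fix i j
      assume ij: "i < dim_row R" "j < dim_col R" "j < i"
      then obtain i' where i': "i = Suc i'" "i' < m"
        using Rc by (cases i) auto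
      show "R $$ (i, j) = 0"
      proof (cases j)
        case 0
        then show ?thesis
          using Ri0 i' by simp
      next
        case (Suc j')
        then show ?thesis
          using IH(3) ij Rc i' n Rij[of i' j'] E unfolding E_def[symmetric] upper_trapezoidal_def by simp
      qed
    qed
    \<comment> \<open>Since only the first entry of the reduced column may be nonzero, it is appreciable exactly when
      the pivot column is.\<close>
    show ?thesis
    proof (cases "st (C $$ (0, 0)) = 0")
      case False
      have diag: "st (R $$ (i, i)) \<noteq> 0" if "i < Suc k'" for i
        using that False R00 Rij IH(4,5,6) unfolding E_def[symmetric] by (cases i) auto
      have low: "st (R $$ (i, j)) = 0" if "Suc k' \<le> i" "i < Suc m" "j < n" for i j
        using that IH(7) Ri0 Rij n unfolding E_def[symmetric] by (cases i; cases j) auto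
      show ?thesis
        using P U trap diag low IH(4,5) n unfolding R_def
        by (intro exI[of _ P] exI[of _ U] exI[of _ "Suc k'"]) auto
    next
      case True
      have "st (B $$ (i, c)) = 0" if i: "i < Suc m" for i
      proof -
        have "B * P1 = conj_transpose U1 * C"
          unfolding C_def using mult_inverse_cancel[OF U1c(2,1,3) BP] by simp
        then have "B $$ (i, c) = (\<Sum>k<Suc m. conj_transpose U1 $$ (i, k) * C $$ (k, 0))"
          using P1(2)[OF B i] mult_mat_entry[OF U1c(2) C i, of 0] n by simp
        also have "st \<dots> = 0"
          unfolding st_sum
        proof (rule sum.neutral, rule ballI)
          fix l
          assume "l \<in> {..<Suc m}"
          then show "st (conj_transpose U1 $$ (i, l) * C $$ (l, 0)) = 0"
            using True C0[of l] by (cases "l = 0") simp_all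
        qed
        finally show ?thesis .
      qed
      then have "st (B $$ (i, j)) = 0" if "i < Suc m" "j < n" for i j
        using c(2) that by blast
      then have "map_mat st B = 0\<^sub>m (Suc m) n"
        using B by (intro eq_matI) auto
      moreover have "map_mat st R = map_mat st U * map_mat st B * map_mat st P"
        unfolding R_def using unitary_matD(1)[OF U] B permutation_mat_carrier[OF P]
        by (simp add: st_hom.mat_hom_mult[of _ "Suc m" n _ n] st_hom.mat_hom_mult[of _ "Suc m" "Suc m" _ n])
      ultimately have "map_mat st R = 0\<^sub>m (Suc m) n"
        using unitary_matD(1)[OF U] permutation_mat_carrier[OF P] by simp
      then have "st (R $$ (i, j)) = 0" if "i < Suc m" "j < n" for i j
        using that Rc by (metis carrier_matD index_map_mat(1) index_zero_mat(1))
      then show ?thesis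
        using P U trap unfolding R_def
        by (intro exI[of _ P] exI[of _ U] exI[of _ 0]) auto
    qed
  qed
qed

section \<open>The appreciable rank\<close>

text \<open>The columns of \<open>M P\<close> are those of \<open>M\<close> in another order, so a row vanishing in \<open>M P\<close> vanishes in \<open>M\<close>.\<close>

lemma permutation_column:
  fixes M :: "'a::semiring_1 mat"
  assumes M: "M \<in> carrier_mat m n" and P: "permutation_mat n P" and j: "j < n"
  obtains l where "l < n" "\<And>i. i < m \<Longrightarrow> M $$ (i, j) = (M * P) $$ (i, l)"
proof -
  obtain \<pi> where \<pi>: "\<pi> permutes {..<n}" "P = mat n n (\<lambda>(i, j). if i = \<pi> j then 1 else 0)"
    using P by (auto simp: permutation_mat_def)
  obtain l where l: "l < n" "\<pi> l = j"
    using permutes_image[OF \<pi>(1)] j by (metis image_iff lessThan_iff)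
  show ?thesis
    using that[OF l(1)] mult_permutation_entry[OF M \<pi>(1) _ l(1)] l(2) \<pi>(2) by simp
qed

text \<open>In the QR decomposition of a matrix with more rows than columns, row \<open>s\<close> of the trapezoidal factor
  vanishes. The corresponding row of the unitary factor is the required combination, and it is nonzero
  by unitarity.\<close>

lemma quat_left_kernel:
  fixes f :: "nat \<Rightarrow> nat \<Rightarrow> quat"
  assumes "s < p"
  obtains w where "\<exists>i<p. w i \<noteq> 0" "\<And>j. j < s \<Longrightarrow> (\<Sum>i<p. w i * f i j) = 0"
proof -
  define B where "B = mat p s (\<lambda>(i, j). Dual (f i j) 0)"
  have B: "B \<in> carrier_mat p s"
    by (simp add: B_def)
  obtain P U where P: "permutation_mat s P" and U: "unitary_mat p U"
    and trap: "upper_trapezoidal (U * B * P)"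
    using pivoted_qr[OF B] by blast
  note Uc = unitary_matD(1)[OF U] and stU = unitary_matD[OF unitary_st[OF U]]
  have UB: "U * B \<in> carrier_mat p s"
    using Uc B by simp
  show ?thesis
  proof (rule that[of "\<lambda>i. st (U $$ (s, i))"])
    show "\<exists>i<p. st (U $$ (s, i)) \<noteq> 0"
    proof (rule ccontr)
      assume "\<not> (\<exists>i<p. st (U $$ (s, i)) \<noteq> 0)"
      then have "(\<Sum>k<p. map_mat st U $$ (s, k) * conj_transpose (map_mat st U) $$ (k, s)) = 0"
        using assms Uc by (intro sum.neutral) auto
      then have "(map_mat st U * conj_transpose (map_mat st U)) $$ (s, s) = 0"
        using mult_mat_entry[OF stU(1,2) assms assms] by simp
      then show False
        using stU(4) assms by simp
    qed
  next
    fix j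
    assume j: "j < s"
    obtain l where l: "l < s" "\<And>i. i < p \<Longrightarrow> (U * B) $$ (i, j) = (U * B * P) $$ (i, l)"
      using permutation_column[OF UB P j] by blast
    have "(U * B) $$ (s, j) = 0"
      using l assms trap Uc permutation_mat_carrier[OF P] unfolding upper_trapezoidal_def
      by (simp del: index_mult_mat(1))
    then have "(\<Sum>k<p. U $$ (s, k) * B $$ (k, j)) = 0"
      using mult_mat_entry[OF Uc B assms j] by simp
    then have "st (\<Sum>k<p. U $$ (s, k) * B $$ (k, j)) = 0"
      by simp
    then show "(\<Sum>i<p. st (U $$ (s, i)) * f i j) = 0"
      using j by (simp add: st_sum B_def)
  qed
qed

text \<open>Every row of \<open>G M\<close> is a left combination of the \<open>s\<close> rows of \<open>M\<close> that may be nonzero, so more than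
  \<open>s\<close> of them are left dependent.\<close>

lemma independent_rows_le:
  fixes G M :: "quat mat"
  assumes G: "G \<in> carrier_mat r r" and M: "M \<in> carrier_mat r n" and p: "p \<le> r"
    and zero: "\<And>i j. s \<le> i \<Longrightarrow> i < r \<Longrightarrow> j < n \<Longrightarrow> M $$ (i, j) = 0"
    and indep: "\<And>w. (\<And>j. j < n \<Longrightarrow> (\<Sum>i<p. w i * (G * M) $$ (i, j)) = 0) \<Longrightarrow> \<forall>i<p. w i = 0"
  shows "p \<le> s"
proof (rule ccontr)
  assume "\<not> p \<le> s"
  then obtain w where w: "\<exists>i<p. w i \<noteq> 0" "\<And>j. j < s \<Longrightarrow> (\<Sum>i<p. w i * G $$ (i, j)) = 0"
    using quat_left_kernel[of s p "\<lambda>i j. G $$ (i, j)"] by auto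
  have "(\<Sum>i<p. w i * (G * M) $$ (i, j)) = 0" if j: "j < n" for j
  proof -
    have "(\<Sum>i<p. w i * (G * M) $$ (i, j)) = (\<Sum>i<p. \<Sum>k<r. w i * G $$ (i, k) * M $$ (k, j))"
    proof (rule sum.cong)
      fix i
      assume "i \<in> {..<p}"
      then have "i < r"
        using p by simp
      from mult_mat_entry[OF G M this j]
      show "w i * (G * M) $$ (i, j) = (\<Sum>k<r. w i * G $$ (i, k) * M $$ (k, j))"
        by (simp add: sum_distrib_left mult.assoc)
    qed simp
    also have "\<dots> = (\<Sum>k<r. \<Sum>i<p. w i * G $$ (i, k) * M $$ (k, j))"
      by (rule sum.swap)
    also have "\<dots> = (\<Sum>k<r. (\<Sum>i<p. w i * G $$ (i, k)) * M $$ (k, j))"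
      by (simp add: sum_distrib_right)
    also have "\<dots> = 0"
    proof (rule sum.neutral, rule ballI)
      fix k
      assume "k \<in> {..<r}"
      then show "(\<Sum>i<p. w i * G $$ (i, k)) * M $$ (k, j) = 0"
        using w(2) zero j by (cases "k < s") auto
    qed
    finally show ?thesis .
  qed
  then show False
    using indep w(1) by blast
qed

text \<open>Forward substitution: column \<open>j\<close> of the relation involves only the coefficients up to \<open>j\<close>, and
  the last of them is multiplied by a nonzero diagonal entry.\<close>

lemma trapezoidal_rows_independent:
  fixes T :: "quat mat"
  assumes T: "T \<in> carrier_mat r n" "upper_trapezoidal T" and k: "k \<le> r" "k \<le> n"
    and diag: "\<And>i. i < k \<Longrightarrow> T $$ (i, i) \<noteq> 0"
    and w: "\<And>j. j < n \<Longrightarrow> (\<Sum>i<k. w i * T $$ (i, j)) = 0"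
  shows "\<forall>i<k. w i = 0"
proof (intro allI impI)
  fix j
  assume "j < k"
  then show "w j = 0"
  proof (induction j rule: less_induct)
    case (less j)
    have "w i * T $$ (i, j) = 0" if "i < k" "i \<noteq> j" for i
    proof (cases "i < j")
      case True
      then show ?thesis
        using less that by simp
    next
      case False
      then have "T $$ (i, j) = 0"
        using T that less.prems k unfolding upper_trapezoidal_def by auto
      then show ?thesis
        by simp
    qed
    then have "(\<Sum>i<k. w i * T $$ (i, j)) = (\<Sum>i<k. if i = j then w j * T $$ (j, j) else 0)"
      by (intro sum.cong) auto
    then have "w j * T $$ (j, j) = 0"
      using w[of j] less.prems k by simp
    then show ?case
      using quat_no_zero_divisors diag less.prems by blast
  qed
qed

text \<open>Multiplying the relation by column \<open>l\<close> of \<open>V\<^sup>*\<close> isolates the coefficient \<open>w l\<close>.\<close>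

lemma scaled_unitary_rows_independent:
  fixes V :: "quat mat" and \<sigma> :: "nat \<Rightarrow> real"
  assumes V: "unitary_mat n V" and p: "p \<le> n" and \<sigma>: "\<And>i. i < p \<Longrightarrow> \<sigma> i \<noteq> 0"
    and w: "\<And>j. j < n \<Longrightarrow> (\<Sum>i<p. w i * (of_real (\<sigma> i) * V $$ (i, j))) = 0"
  shows "\<forall>i<p. w i = 0"
proof (intro allI impI)
  fix l
  assume l: "l < p"
  note v = unitary_matD[OF V]
  have orth: "(\<Sum>j<n. V $$ (i, j) * conj_transpose V $$ (j, l)) = (if i = l then 1 else 0)" if "i < p" for i
    using mult_mat_entry[OF v(1,2), of i l] that l p v(4) by simp
  have "0 = (\<Sum>j<n. (\<Sum>i<p. w i * (of_real (\<sigma> i) * V $$ (i, j))) * conj_transpose V $$ (j, l))"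
    using w by simp
  also have "\<dots> = (\<Sum>j<n. \<Sum>i<p. w i * of_real (\<sigma> i) * (V $$ (i, j) * conj_transpose V $$ (j, l)))"
    by (simp add: sum_distrib_right mult.assoc)
  also have "\<dots> = (\<Sum>i<p. \<Sum>j<n. w i * of_real (\<sigma> i) * (V $$ (i, j) * conj_transpose V $$ (j, l)))"
    by (rule sum.swap)
  also have "\<dots> = (\<Sum>i<p. w i * of_real (\<sigma> i) * (\<Sum>j<n. V $$ (i, j) * conj_transpose V $$ (j, l)))"
    by (simp add: sum_distrib_left)
  also have "\<dots> = (\<Sum>i<p. if i = l then w i * of_real (\<sigma> i) else 0)"
    using orth by (intro sum.cong) simp_all
  also have "\<dots> = \<sigma> l *\<^sub>R w l"
    using l by (simp add: of_real_def)
  finally show "w l = 0"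
    using \<sigma>[OF l] by simp
qed

lemma card_eq_lessThan:
  fixes T :: "nat set"
  assumes "finite T" "\<And>i j. i \<le> j \<Longrightarrow> j \<in> T \<Longrightarrow> i \<in> T"
  shows "T = {..<card T}"
proof -
  have "i < card T" if "i \<in> T" for i
  proof -
    have "{..i} \<subseteq> T"
      using assms(2)[OF _ that] by auto
    then show ?thesis
      using card_mono[OF assms(1), of "{..i}"] by simp
  qed
  then show ?thesis
    by (intro card_subset_eq) auto
qed

text \<open>An appreciable positive dual number exceeds every infinitesimal one, so the appreciable entries
  form an initial segment of the list.\<close>

lemma appreciable_iff_index:
  fixes \<mu>s :: "real dual list"
  assumes "sorted_wrt (\<ge>) \<mu>s" "\<forall>\<mu>\<in>set \<mu>s. 0 < \<mu>" "i < length \<mu>s"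
  shows "appreciable (\<mu>s ! i) \<longleftrightarrow> i < length (filter appreciable \<mu>s)"
proof -
  define T where "T = {i. i < length \<mu>s \<and> appreciable (\<mu>s ! i)}"
  have down: "i \<in> T" if "i \<le> j" "j \<in> T" for i j
  proof -
    have ij: "j < length \<mu>s" "i < length \<mu>s" "appreciable (\<mu>s ! j)"
      using that by (auto simp: T_def)
    then have "\<mu>s ! j \<le> \<mu>s ! i"
      using that assms(1) by (cases "i = j") (auto simp: sorted_wrt_iff_nth_less)
    moreover have "0 < \<mu>s ! j"
      using assms(2) ij by simp
    ultimately show ?thesis
      using ij by (auto simp: T_def less_dual_def less_eq_dual_def appreciable_def)
  qed
  have "finite T"
    by (simp add: T_def)
  from card_eq_lessThan[OF this] down have "T = {..<card T}"
    by metis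
  moreover have "card T = length (filter appreciable \<mu>s)"
    by (simp add: T_def length_filter_conv_card)
  ultimately have "T = {..<length (filter appreciable \<mu>s)}"
    by metis
  then have "i \<in> T \<longleftrightarrow> i < length (filter appreciable \<mu>s)"
    by (metis lessThan_iff)
  then show ?thesis
    using assms(3) by (simp add: T_def)
qed

section \<open>The decomposition\<close>

lemma append_rows_entry:
  assumes "B \<in> carrier_mat r n" "C \<in> carrier_mat l n" "i < r + l" "j < n"
  shows "(B @\<^sub>r C) $$ (i, j) = (if i < r then B $$ (i, j) else C $$ (i - r, j))"
  using assms by (simp add: append_rows_def)

lemma append_zero_rows_mult:
  fixes B P :: "'a::semiring_0 mat"
  assumes B: "B \<in> carrier_mat r n" and P: "P \<in> carrier_mat n l"
  shows "(B @\<^sub>r 0\<^sub>m t n) * P = (B * P) @\<^sub>r 0\<^sub>m t l"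
proof (rule eq_matI)
  have Z: "B @\<^sub>r 0\<^sub>m t n \<in> carrier_mat (r + t) n" and BP: "B * P \<in> carrier_mat r l"
    using B P by (auto intro!: carrier_append_rows)
  fix i j
  assume "i < dim_row ((B * P) @\<^sub>r 0\<^sub>m t l)" "j < dim_col ((B * P) @\<^sub>r 0\<^sub>m t l)"
  then have ij: "i < r + t" "j < l"
    using B P by (simp_all add: append_rows_def)
  have "((B @\<^sub>r 0\<^sub>m t n) * P) $$ (i, j) = (\<Sum>k<n. (B @\<^sub>r 0\<^sub>m t n) $$ (i, k) * P $$ (k, j))"
    by (rule mult_mat_entry[OF Z P ij])
  also have "\<dots> = (if i < r then \<Sum>k<n. B $$ (i, k) * P $$ (k, j) else 0)"
    using B ij by (auto simp: append_rows_entry[of B r n "0\<^sub>m t n" t] intro!: sum.cong)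
  also have "\<dots> = ((B * P) @\<^sub>r 0\<^sub>m t l) $$ (i, j)"
    using ij by (simp add: append_rows_entry[OF BP, of _ t] mult_mat_entry[OF B P] del: index_mult_mat)
  finally show "((B @\<^sub>r 0\<^sub>m t n) * P) $$ (i, j) = ((B * P) @\<^sub>r 0\<^sub>m t l) $$ (i, j)" .
qed (use B P in \<open>simp_all add: append_rows_def\<close>)

lemma block_diag_mult_append_zero_rows:
  fixes W R :: "'a::semiring_1 mat"
  assumes "W \<in> carrier_mat r r" "R \<in> carrier_mat r n"
  shows "four_block_mat W (0\<^sub>m r t) (0\<^sub>m t r) (1\<^sub>m t) * (R @\<^sub>r 0\<^sub>m t n) = (W * R) @\<^sub>r 0\<^sub>m t n"
  using assms unfolding append_rows_def
  by (subst mult_four_block_mat[of _ r r _ t _ t _ _ n _ 0]) simp_all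

text \<open>Only the first \<open>length \<mu>s\<close> rows of the diagonal matrix are nonzero, so the decomposition involves only
  that many rows of \<open>V\<^sup>*\<close>.\<close>

lemma svd_reduced:
  assumes A: "A \<in> carrier_mat m n" and svd: "is_svd A U V \<mu>s"
  defines "r \<equiv> length \<mu>s"
  defines "B \<equiv> mat r n (\<lambda>(i, j). dquat_of_dual (\<mu>s ! i) * conj_transpose V $$ (i, j))"
  shows "A = U * (B @\<^sub>r 0\<^sub>m (m - r) n)"
proof -
  have U: "unitary_mat m U" and V: "unitary_mat n V" and r: "r \<le> m" "r \<le> n"
    and D: "conj_transpose U * A * V = svd_diag m n \<mu>s"
    using svd A by (auto simp: is_svd_def r_def)
  note u = unitary_matD[OF U] and v = unitary_matD[OF V]
  have Dc: "svd_diag m n \<mu>s \<in> carrier_mat m n"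
    by (simp add: svd_diag_def)
  have "svd_diag m n \<mu>s * conj_transpose V = conj_transpose U * A"
    unfolding D[symmetric] using u v A by (intro mult_inverse_cancel_right[of _ n]) auto
  then have "A = U * (svd_diag m n \<mu>s * conj_transpose V)"
    using mult_inverse_cancel[OF u(1,2,4) A] by simp
  also have "svd_diag m n \<mu>s * conj_transpose V = B @\<^sub>r 0\<^sub>m (m - r) n"
  proof (rule eq_matI)
    have B: "B \<in> carrier_mat r n"
      by (simp add: B_def)
    fix i j
    assume "i < dim_row (B @\<^sub>r 0\<^sub>m (m - r) n)" "j < dim_col (B @\<^sub>r 0\<^sub>m (m - r) n)"
    then have ij: "i < m" "j < n"
      using B r by (simp_all add: append_rows_def)
    have "(svd_diag m n \<mu>s * conj_transpose V) $$ (i, j)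
        = (\<Sum>k<n. svd_diag m n \<mu>s $$ (i, k) * conj_transpose V $$ (k, j))"
      by (rule mult_mat_entry[OF Dc v(2) ij])
    also have "\<dots> = (\<Sum>k<n. if k = i then
        (if i < r then dquat_of_dual (\<mu>s ! i) * conj_transpose V $$ (i, j) else 0) else 0)"
      using ij by (intro sum.cong) (auto simp: svd_diag_def r_def)
    also have "\<dots> = (B @\<^sub>r 0\<^sub>m (m - r) n) $$ (i, j)"
      using append_rows_entry[OF B, of "0\<^sub>m (m - r) n" "m - r" i j] ij r by (simp add: B_def)
    finally show "(svd_diag m n \<mu>s * conj_transpose V) $$ (i, j) = (B @\<^sub>r 0\<^sub>m (m - r) n) $$ (i, j)" .
  qed (use r v in \<open>simp_all add: append_rows_def B_def svd_diag_def\<close>)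
  finally show ?thesis .
qed

lemma st_dquat_of_dual: "st (dquat_of_dual x) = of_real (st x)"
  by (simp add: dquat_of_dual_def dual.map_sel)

lemma infinitesimal_row_iff:
  "i < dim_row R \<Longrightarrow> infinitesimal_vec (row R i) \<longleftrightarrow> (\<forall>j<dim_col R. st (R $$ (i, j)) = 0)"
  by (auto simp: infinitesimal_vec_def vec_eq_iff)

theorem theorem3p1:
  fixes A :: "dquat mat" and m n r :: nat
  assumes "A \<in> carrier_mat m n"
    and "dq_rank A = r"
    and "r > 0"
  shows "\<exists>P Q R. permutation_mat n P \<and> unitary_mat m Q \<and>
    R \<in> carrier_mat r n \<and> upper_trapezoidal R \<and>
    A * P = Q * (R @\<^sub>r 0\<^sub>m (m - r) n) \<and>
    card {i. i < r \<and> \<not> infinitesimal_vec (row R i)} = Arank A"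
proof -
  define \<mu>s where "\<mu>s = singular_values A"
  have r: "r = length \<mu>s"
    using assms(2) by (simp add: dq_rank_def \<mu>s_def)
  \<comment> \<open>The default \<open>[]\<close> has length \<open>0\<close>, so the positive rank comes from an actual decomposition.\<close>
  have "\<exists>\<mu>s U V. is_svd A U V \<mu>s"
    using assms(3) r by (auto simp: \<mu>s_def singular_values_def split: if_splits)
  then have "\<exists>U V. is_svd A U V \<mu>s"
    using someI_ex[of "\<lambda>\<mu>s. \<exists>U V. is_svd A U V \<mu>s"] by (simp add: \<mu>s_def singular_values_def)
  then obtain U V where svd: "is_svd A U V \<mu>s"
    by blast
  have U: "unitary_mat m U" and V: "unitary_mat n V" and rmn: "r \<le> m" "r \<le> n"
    and sorted: "sorted_wrt (\<ge>) \<mu>s" "\<forall>\<mu>\<in>set \<mu>s. 0 < \<mu>"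
    using svd assms(1) by (auto simp: is_svd_def r)
  define B where "B = mat r n (\<lambda>(i, j). dquat_of_dual (\<mu>s ! i) * conj_transpose V $$ (i, j))"
  have AB: "A = U * (B @\<^sub>r 0\<^sub>m (m - r) n)"
    using svd_reduced[OF assms(1) svd] by (simp add: B_def r)
  have B: "B \<in> carrier_mat r n"
    by (simp add: B_def)
  obtain P W k where P: "permutation_mat n P" and W: "unitary_mat r W"
    and trap: "upper_trapezoidal (W * B * P)" and k: "k \<le> r" "k \<le> n"
    and diag: "\<And>i. i < k \<Longrightarrow> st ((W * B * P) $$ (i, i)) \<noteq> 0"
    and low: "\<And>i j. k \<le> i \<Longrightarrow> i < r \<Longrightarrow> j < n \<Longrightarrow> st ((W * B * P) $$ (i, j)) = 0"
    using pivoted_qr[OF B] by blast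
  define R where "R = W * B * P"
  note w = unitary_matD[OF W] and u = unitary_matD[OF U] and Pc = permutation_mat_carrier[OF P]
  have R: "R \<in> carrier_mat r n" and WB: "W * B \<in> carrier_mat r n" and BP: "B * P \<in> carrier_mat r n"
    using w B Pc by (simp_all add: R_def)
  have R_eq: "R = W * (B * P)"
    unfolding R_def using w B Pc by (intro assoc_mult_mat) auto
  define G where "G = four_block_mat (conj_transpose W) (0\<^sub>m r (m - r)) (0\<^sub>m (m - r) r) (1\<^sub>m (m - r))"
  have G: "unitary_mat m G"
    using unitary_block_diag[OF unitary_conj_transpose[OF W] unitary_one[of "m - r"]] rmn
    by (simp add: G_def)
  have "A * P = U * ((B @\<^sub>r 0\<^sub>m (m - r) n) * P)"
    unfolding AB using u(1) B Pc rmn carrier_append_rows[OF B zero_carrier_mat[of "m - r" n]]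
    by (intro assoc_mult_mat) auto
  also have "(B @\<^sub>r 0\<^sub>m (m - r) n) * P = (conj_transpose W * R) @\<^sub>r 0\<^sub>m (m - r) n"
    using append_zero_rows_mult[OF B Pc] mult_inverse_cancel[OF w(2,1,3) BP] by (simp add: R_eq)
  also have "\<dots> = G * (R @\<^sub>r 0\<^sub>m (m - r) n)"
    unfolding G_def by (rule block_diag_mult_append_zero_rows[OF w(2) R, symmetric])
  also have "U * \<dots> = U * G * (R @\<^sub>r 0\<^sub>m (m - r) n)"
    using u(1) unitary_matD(1)[OF G] rmn carrier_append_rows[OF R zero_carrier_mat[of "m - r" n]]
    by (intro assoc_mult_mat[symmetric]) auto
  finally have APQR: "A * P = U * G * (R @\<^sub>r 0\<^sub>m (m - r) n)" .
  define p where "p = Arank A"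
  have p: "p = length (filter appreciable \<mu>s)"
    by (simp add: p_def Arank_def \<mu>s_def)
  then have pr: "p \<le> r"
    by (simp add: r)
  have appr: "st (\<mu>s ! i) \<noteq> 0 \<longleftrightarrow> i < p" if "i < r" for i
    using appreciable_iff_index[OF sorted, of i] that by (simp add: r p appreciable_def)
  note stW = unitary_matD[OF unitary_st[OF W]]
  have stB: "st (B $$ (i, j)) = of_real (st (\<mu>s ! i)) * conj_transpose (map_mat st V) $$ (i, j)"
    if "i < r" "j < n" for i j
    using that rmn unitary_matD(2)[OF V]
    by (simp add: B_def st_dquat_of_dual flip: st_conj_transpose)
  \<comment> \<open>Here \<open>R\<close> is a combination of the rows of \<open>B P\<close>, of which the standard parts vanish from row \<open>p\<close> on.\<close>
  have "k \<le> p"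
  proof (rule independent_rows_le[OF stW(1) _ k(1)])
    show "map_mat st (B * P) \<in> carrier_mat r n"
      using BP by simp
    show "map_mat st (B * P) $$ (i, j) = 0" if "p \<le> i" "i < r" "j < n" for i j
    proof -
      have "map_mat st (B * P) $$ (i, j) = st ((B * P) $$ (i, j))"
        using that BP by (intro index_map_mat(1)) auto
      also have "\<dots> = (\<Sum>l<n. st (B $$ (i, l)) * st (P $$ (l, j)))"
        using mult_mat_entry[OF B Pc that(2,3)] by (simp add: st_sum)
      also have "\<dots> = 0"
        using that appr[of i] by (intro sum.neutral) (simp add: stB)
      finally show ?thesis .
    qed
    have T: "map_mat st W * map_mat st (B * P) = map_mat st R"
      unfolding R_eq by (rule st_hom.mat_hom_mult[OF w(1) BP, symmetric])
    show "\<forall>i<k. v i = 0"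
      if "\<And>j. j < n \<Longrightarrow> (\<Sum>i<k. v i * (map_mat st W * map_mat st (B * P)) $$ (i, j)) = 0" for v
    proof (rule trapezoidal_rows_independent[OF _ _ k])
      show "map_mat st R \<in> carrier_mat r n"
        using R by simp
      show "upper_trapezoidal (map_mat st R)"
        using trap by (simp add: upper_trapezoidal_def R_def)
      show "map_mat st R $$ (i, i) \<noteq> 0" if "i < k" for i
        using diag[OF that] that k R by (simp flip: R_def)
      show "(\<Sum>i<k. v i * map_mat st R $$ (i, j)) = 0" if "j < n" for j
        using \<open>\<And>j. j < n \<Longrightarrow> (\<Sum>i<k. v i * (map_mat st W * map_mat st (B * P)) $$ (i, j)) = 0\<close>[OF that]
        by (simp only: T)
    qed
  qed
  \<comment> \<open>Conversely, \<open>B\<close> is a combination of the rows of \<open>W B\<close>, whose entries are those of \<open>R\<close> up to the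
    order of the columns.\<close>
  moreover have "p \<le> k"
  proof (rule independent_rows_le[OF stW(2) _ pr])
    show "map_mat st (W * B) \<in> carrier_mat r n"
      using WB by simp
    show "map_mat st (W * B) $$ (i, j) = 0" if "k \<le> i" "i < r" "j < n" for i j
      using permutation_column[OF WB P that(3)] low[OF that(1,2)] that WB
      by (metis carrier_matD index_map_mat(1))
    have T: "conj_transpose (map_mat st W) * map_mat st (W * B) = map_mat st B"
      using mult_inverse_cancel[OF w(2,1,3) B] st_hom.mat_hom_mult[OF w(2) WB]
      by (simp add: st_conj_transpose)
    show "\<forall>i<p. v i = 0"
      if v: "\<And>j. j < n \<Longrightarrow> (\<Sum>i<p. v i * (conj_transpose (map_mat st W) * map_mat st (W * B)) $$ (i, j)) = 0" for v
    proof (rule scaled_unitary_rows_independent[OF unitary_conj_transpose[OF unitary_st[OF V]]])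
      show "p \<le> n"
        using pr rmn by simp
      show "st (\<mu>s ! i) \<noteq> 0" if "i < p" for i
        using appr[of i] that pr by simp
      show "(\<Sum>i<p. v i * (of_real (st (\<mu>s ! i)) * conj_transpose (map_mat st V) $$ (i, j))) = 0"
        if "j < n" for j
      proof -
        have "(\<Sum>i<p. v i * (of_real (st (\<mu>s ! i)) * conj_transpose (map_mat st V) $$ (i, j)))
            = (\<Sum>i<p. v i * map_mat st B $$ (i, j))"
          using that pr B by (intro sum.cong) (simp_all add: stB)
        then show ?thesis
          using v[OF that] by (simp only: T)
      qed
    qed
  qed
  ultimately have kp: "k = p"
    by simp
  have "{i. i < r \<and> \<not> infinitesimal_vec (row R i)} = {..<k}"
  proof (rule Set.set_eqI)
    fix i
    show "i \<in> {i. i < r \<and> \<not> infinitesimal_vec (row R i)} \<longleftrightarrow> i \<in> {..<k}"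
    proof (cases "i < k")
      case True
      then have "i < r" "i < n" "st (R $$ (i, i)) \<noteq> 0"
        using diag[of i] k by (simp_all add: R_def del: index_mult_mat(1))
      then show ?thesis
        using True R by (auto simp: infinitesimal_row_iff)
    next
      case False
      then show ?thesis
        using low[of i] R unfolding R_def[symmetric] by (auto simp: infinitesimal_row_iff)
    qed
  qed
  then have "card {i. i < r \<and> \<not> infinitesimal_vec (row R i)} = Arank A"
    by (simp add: kp p_def)
  then show ?thesis
    using P unitary_mult[OF U G] R trap APQR unfolding R_def[symmetric] by blast
qed

end
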